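(* Let $f:\mathbb{Z}_+\to\mathbb{R}$ be an L-additive function which is not identically zero. Then the function $h_f$ associated with $f$ is unique, and for all $n\in\mathbb{Z}_+$, $$h_f(n)=\Big(\prod_{p\in U_f}\Big(\frac{f(p^2)}{2f(p)}\Big)^{\nu_p(n)}\Big)\Big(\prod_{p\in V_f}\Big(\frac{f(pq)}{f(q)}\Big)^{\nu_p(n)}\Big),$$ where $q\in U_f$ is arbitrary (and the second product is $1$ if $V_f=\emptyset$).
   Context: $\mathbb{P}$ is the set of primes. For $n\in\mathbb{Z}_+$ and $p\in\mathbb{P}$, $\nu_p(n)$ is the exponent of $p$ in the prime factorization of $n$. An arithmetic function $h$ is completely multiplicative if $h(1)=1$ and $h(mn)=h(m)h(n)$ for all $m,n\in\mathbb{Z}_+$. An arithmetic function $f$ is L-additive if there is a nonzero-valued completely multiplicative function $h_f$ such that $f(mn)=f(m)h_f(n)+f(n)h_f(m)$ for all $m,n\in\mathbb{Z}_+$. $U_f=\{p\in\mathbb{P}: f(p)\neq 0\}$ and $V_f=\{p\in\mathbb{P}: f(p)=0\}$. *)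

theory Defs
  imports Complex_Main "HOL-Computational_Algebra.Primes"
begin

(* Functions on the positive integers are modelled as functions on nat; the value at 0 is
   unconstrained and never used. *)

definition completely_multiplicative :: "(nat \<Rightarrow> real) \<Rightarrow> bool" where
  "completely_multiplicative h \<longleftrightarrow> h 1 = 1 \<and> (\<forall>m>0. \<forall>n>0. h (m * n) = h m * h n)"

definition associated :: "(nat \<Rightarrow> real) \<Rightarrow> (nat \<Rightarrow> real) \<Rightarrow> bool" where
  "associated f h \<longleftrightarrow> completely_multiplicative h \<and> (\<forall>n>0. h n \<noteq> 0) \<and>
     (\<forall>m>0. \<forall>n>0. f (m * n) = f m * h n + f n * h m)"

definition L_additive :: "(nat \<Rightarrow> real) \<Rightarrow> bool" where
  "L_additive f \<longleftrightarrow> (\<exists>h. associated f h)"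

definition U_set :: "(nat \<Rightarrow> real) \<Rightarrow> nat set" where
  "U_set f = {p. prime p \<and> f p \<noteq> 0}"

definition V_set :: "(nat \<Rightarrow> real) \<Rightarrow> nat set" where
  "V_set f = {p. prime p \<and> f p = 0}"

(* U_set f and V_set f may be infinite, where prod would be 1 by convention. Products over them
   are therefore taken with prod', which multiplies the factors different from 1; the next
   lemma shows that there are only finitely many of these. *)
lemma finite_nontrivial_prime_powers:
  fixes n :: nat and c :: "nat \<Rightarrow> real"
  assumes "n > 0"
  shows "finite {p \<in> A. c p ^ multiplicity p n \<noteq> 1}"
proof (rule finite_subset)
  show "{p \<in> A. c p ^ multiplicity p n \<noteq> 1} \<subseteq> {p. p dvd n}"
  proof clarify
    fix p assume "c p ^ multiplicity p n \<noteq> 1"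
    then have "multiplicity p n \<noteq> 0" by (metis power_0)
    then show "p dvd n" by (metis not_dvd_imp_multiplicity_0)
  qed
  show "finite {p. p dvd n}" using assms by simp
qed

end

theory Submission
  imports Defs
begin

text \<open>
  At a prime \<open>p\<close> with \<open>f p \<noteq> 0\<close> the identity \<open>f (p\<^sup>2) = 2 f p h p\<close> determines \<open>h p\<close>; at a prime
  with \<open>f p = 0\<close> the identity \<open>f (p q) = f q h p\<close> does, for any \<open>q\<close> with \<open>f q \<noteq> 0\<close>. A suitable
  prime \<open>q\<close> exists, because an L-additive function vanishing at all primes vanishes everywhere.
  Complete multiplicativity then gives \<open>h\<close> at every \<open>n\<close>.
\<close>

lemma completely_multiplicative_power:
  assumes "completely_multiplicative h" and "m > 0"
  shows "h (m ^ k) = h m ^ k"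
  using assms by (induction k) (auto simp: completely_multiplicative_def)

lemma completely_multiplicative_prod:
  assumes "completely_multiplicative h" and "finite A" and "\<And>x. x \<in> A \<Longrightarrow> g x > 0"
  shows "h (prod g A) = (\<Prod>x\<in>A. h (g x))"
  using assms(2,3)
proof (induction A rule: finite_induct)
  case empty
  then show ?case using assms(1) by (simp add: completely_multiplicative_def)
next
  case (insert x A)
  then have "g x > 0" "prod g A > 0" by (auto intro: prod_pos)
  then have "h (g x * prod g A) = h (g x) * h (prod g A)"
    using assms(1) by (simp add: completely_multiplicative_def)
  with insert show ?case by simp
qed

lemma completely_multiplicative_eq_prod_prime_factors:
  assumes "completely_multiplicative h" and "n > 0"
  shows "h n = (\<Prod>p\<in>prime_factors n. h p ^ multiplicity p n)"
proof -
  have pos: "p > 0" if "p \<in> prime_factors n" for p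
    using that by (auto intro: prime_gt_0_nat)
  have "h n = h (\<Prod>p\<in>prime_factors n. p ^ multiplicity p n)"
    using prime_factorization_nat[OF assms(2)] by simp
  also have "\<dots> = (\<Prod>p\<in>prime_factors n. h (p ^ multiplicity p n))"
    using pos by (intro completely_multiplicative_prod assms(1)) auto
  also have "\<dots> = (\<Prod>p\<in>prime_factors n. h p ^ multiplicity p n)"
    using pos by (intro prod.cong refl completely_multiplicative_power assms(1)) auto
  finally show ?thesis .
qed

text \<open>A prime not dividing \<open>n\<close> has exponent 0 and contributes the factor 1. This
  trades a product over a possibly infinite set of primes for an ordinary finite one.\<close>

lemma prod'_multiplicity_eq_prod_prime_factors:
  fixes c :: "nat \<Rightarrow> real"
  assumes "n > 0" and "\<And>p. p \<in> A \<Longrightarrow> prime p"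
  shows "prod' (\<lambda>p. c p ^ multiplicity p n) A =
    (\<Prod>p\<in>A \<inter> prime_factors n. c p ^ multiplicity p n)"
proof -
  have "p \<in> prime_factors n" if "p \<in> A" "c p ^ multiplicity p n \<noteq> 1" for p
  proof -
    have "multiplicity p n \<noteq> 0"
      using that(2) by (metis power_0)
    then show ?thesis
      using assms(2)[OF that(1)] by (simp add: prime_factors_multiplicity)
  qed
  \<comment> \<open>The inclusion can be strict: a prime factor of \<open>n\<close> with
    \<open>c p = 1\<close>, for instance, also contributes 1.\<close>
  then have "{p \<in> A. c p ^ multiplicity p n \<noteq> 1} \<subseteq> A \<inter> prime_factors n"
    by blast
  then show ?thesis
    using finite_nontrivial_prime_powers[OF assms(1), of A c]
    by (auto simp: prod.G_def intro!: prod.mono_neutral_left)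
qed

text \<open>Both terms of \<open>f p * h x + f x * h p\<close> vanish, so zeros propagate from the
  primes to all products of primes.\<close>

lemma associated_eq_zero:
  assumes "associated f h" and "\<And>p. prime p \<Longrightarrow> f p = 0" and "n > 0"
  shows "f n = 0"
proof -
  have mult: "f (k * m) = f k * h m + f m * h k" if "k > 0" "m > 0" for k m
    using assms(1) that by (simp add: associated_def)
  have "h 1 = 1"
    using assms(1) by (simp add: associated_def completely_multiplicative_def)
  \<comment> \<open>Taking both arguments equal to 1 gives \<open>f 1 = 2 * f 1\<close>.\<close>
  then have one: "f 1 = 0"
    using mult[of 1 1] by simp
  \<comment> \<open>Positivity stays inside the induction claim because the induction has a case for
    0, where \<open>f\<close> is unconstrained.\<close>
  have "n > 0 \<longrightarrow> f n = 0"
  proof (induction n rule: prime_divisors_induct)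
    case (factor p x)
    then show ?case
      using mult[of p x] assms(2)[of p] by (auto simp: prime_gt_0_nat)
  qed (use one in simp_all)
  with assms(3) show ?thesis by simp
qed

lemma U_set_nonempty:
  assumes "associated f h" and "n > 0" and "f n \<noteq> 0"
  shows "U_set f \<noteq> {}"
  using associated_eq_zero[OF assms(1) _ assms(2)] assms(3) by (auto simp: U_set_def)

lemma associated_at_U_set:
  assumes "associated f h" and "p \<in> U_set f"
  shows "f (p\<^sup>2) / (2 * f p) = h p"
  using assms prime_gt_0_nat[of p]
  by (auto simp: associated_def U_set_def power2_eq_square)

lemma associated_at_V_set:
  assumes "associated f h" and "p \<in> V_set f" and "q \<in> U_set f"
  shows "f (p * q) / f q = h p"
  using assms prime_gt_0_nat[of p] prime_gt_0_nat[of q]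
  by (auto simp: associated_def U_set_def V_set_def)

text \<open>Each prime lies in exactly one of \<open>U_set f\<close> and \<open>V_set f\<close>, so
  the factorization of \<open>h n\<close> over the prime factors of \<open>n\<close> splits into the
  two products.\<close>

lemma associated_formula:
  assumes assoc: "associated f h" and q: "q \<in> U_set f" and n: "n > 0"
  shows "h n = prod' (\<lambda>p. (f (p\<^sup>2) / (2 * f p)) ^ multiplicity p n) (U_set f) *
    prod' (\<lambda>p. (f (p * q) / f q) ^ multiplicity p n) (V_set f)"
proof -
  let ?P = "prime_factors n" and ?g = "\<lambda>p. h p ^ multiplicity p n"
  have U: "prod' (\<lambda>p. (f (p\<^sup>2) / (2 * f p)) ^ multiplicity p n) (U_set f) =
      prod ?g (U_set f \<inter> ?P)"
    using n by (subst prod'_multiplicity_eq_prod_prime_factors)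
      (auto simp: associated_at_U_set[OF assoc] U_set_def[of f] intro!: prod.cong)
  have V: "prod' (\<lambda>p. (f (p * q) / f q) ^ multiplicity p n) (V_set f) =
      prod ?g (V_set f \<inter> ?P)"
    using n by (subst prod'_multiplicity_eq_prod_prime_factors)
      (auto simp: associated_at_V_set[OF assoc _ q] V_set_def[of f] intro!: prod.cong)
  have "?P = (U_set f \<inter> ?P) \<union> (V_set f \<inter> ?P)"
    by (auto simp: U_set_def V_set_def)
  moreover have "prod ?g ((U_set f \<inter> ?P) \<union> (V_set f \<inter> ?P)) =
      prod ?g (U_set f \<inter> ?P) * prod ?g (V_set f \<inter> ?P)"
    by (rule prod.union_disjoint) (auto simp: U_set_def V_set_def)
  moreover have "h n = prod ?g ?P"
    using assoc n
    by (intro completely_multiplicative_eq_prod_prime_factors) (auto simp: associated_def)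
  ultimately show ?thesis
    unfolding U V by metis
qed

theorem theorem4:
  fixes f :: "nat \<Rightarrow> real"
  assumes "L_additive f" and "\<exists>n>0. f n \<noteq> 0"
  shows "(\<forall>h h'. associated f h \<and> associated f h' \<longrightarrow> (\<forall>n>0. h n = h' n)) \<and>
    U_set f \<noteq> {} \<and>
    (\<forall>h. associated f h \<longrightarrow> (\<forall>q\<in>U_set f. \<forall>n>0.
       h n = prod' (\<lambda>p. (f (p\<^sup>2) / (2 * f p)) ^ multiplicity p n) (U_set f) *
             prod' (\<lambda>p. (f (p * q) / f q) ^ multiplicity p n) (V_set f)))"
proof (intro conjI allI impI ballI)
  show nonempty: "U_set f \<noteq> {}"
    using assms U_set_nonempty by (auto simp: L_additive_def)
  fix h h' :: "nat \<Rightarrow> real" and n :: nat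
  assume "associated f h \<and> associated f h'" and "n > 0"
  moreover obtain q where "q \<in> U_set f"
    using nonempty by blast
  \<comment> \<open>The right-hand side of the formula depends only on \<open>f\<close>,
    \<open>q\<close> and \<open>n\<close>, so with a common \<open>q\<close> both functions take the
    same value.\<close>
  ultimately show "h n = h' n"
    using associated_formula[of f h q n] associated_formula[of f h' q n] by simp
qed (rule associated_formula)

end
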